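(* For every equation system $\Xi$ and every pair of finite trees $t_1, t_2 \in T$, the computation of $\mathit{unify}_\Xi(t_1,t_2)$ terminates, i.e. it makes only finitely many recursive calls and ends either with an equation system or with failure $\bot$.
   Context: **Trees.** $\mathbb{V}$ (variables) and $\mathbb{C}$ (constructors) are countably infinite sets, with an arity function $\mathbb{C}\to\mathbb{N}$ (arity $0$ allowed); $f^n$ denotes a constructor $f$ of arity $n$. The set $T$ of finite trees is the least set containing $\mathbb{V}$ and all $f^n(t_1,\dots,t_n)$ with $t_i\in T$. A head tree is a tree $f^n(x_1,\dots,x_n)$ with all $x_i\in\mathbb{V}$; $T^H$ is the set of head trees. **Equation systems.** An equation is written $[X\equiv y,\,t]$, where $X$ is a non-empty finite set of variables, $y\in X$ is the representing variable, and $t$ is either a head tree or $\bot$ (missing). An equation system $\Xi$ is a finite set of equations with pairwise disjoint left-hand sides $X$. $dom(\Xi)$ is the union of its left-hand sides. $\Xi,(X\equiv x,t)$ denotes the system obtained by removing from $\Xi$ all equations whose left-hand side intersects $X$ and then adding $[X\equiv x,t]$. **Operations.** - $\mathit{find}_\Xi(x)=(x,\bot)$ if $x\notin dom(\Xi)$; $\mathit{find}_\Xi(x)=(x',t)$ if $[X\equiv x',t]\in\Xi$ and $x\in X$. - $bind_\Xi(x,t)=\Xi,(\{x\}\equiv x,t)$ if $x\notin dom(\Xi)$; $bind_\Xi(x,t)=\Xi,(X\equiv x',t)$ if $[X\equiv x',t']\in\Xi$ and $x\in X$ (here $t\in T^H$). - $union_\Xi(x,y)$ returns an equation system together with either $\bot$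 or a pair of head trees: (i) $union_\Xi(x,x)=\Xi,\bot$; (ii) if $x\ne y$ and $x,y\notin dom(\Xi)$: $[\Xi,(\{x,y\}\equiv x,\bot)],\bot$; (iii) if $[X\equiv x',t]\in\Xi$, $x\in X$, $y\notin dom(\Xi)$: $[\Xi,(X\cup\{y\}\equiv x',t)],\bot$; (iv) if $x\notin dom(\Xi)$ and $y\in dom(\Xi)$: $union_\Xi(y,x)$; (v) if $x,y$ belong to the left-hand side of the same equation: $\Xi,\bot$; (vi) if $[X\equiv x',t_1],[Y\equiv y',t_2]\in\Xi$ are distinct equations, $x\in X$, $y\in Y$: if $t_1,t_2$ are both head trees, the result is $[\Xi,(X\cup Y\equiv x',t_1)],(t_1,t_2)$; otherwise it is $[\Xi,(X\cup Y\equiv x',t)],\bot$, where $t$ is the one of $t_1,t_2$ that is a head tree if there is one, and $t=\bot$ otherwise. **Unification algorithm.** $\mathit{unify}_\Xi(t,s)$, for $t,s\in T$, returns an equation system or $\bot$ (failure), according to the following rules; failure of any recursive call makes the whole computation fail. - For variables $x,y$: if $union_\Xi(x,y)=\Xi',\bot$, the result is $\Xi'$; if $union_\Xi(x,y)=\Xi',(t_1,t_2)$, the result is $\mathit{unify}_{\Xi'}(t_1,t_2)$. - For a variable $x$ and a non-variable tree $t=f^n(t_1,\dots,t_n)$: if $\mathit{find}_\Xi(x)=(x',t')$ with $t'\neq\bot$, the result is $\mathit{unify}_\Xi(t',t)$. If $\mathit{find}_\Xi(x)=(x',\bot)$, choose fresh distinct variables $y_1,\dots,y_n$ (distinct from all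 variables occurring in the inputs, in $\Xi$, and from all variables generated so far), set $\Xi_0=bind_\Xi(x',f^n(y_1,\dots,y_n))$ and $\Xi_i=\mathit{unify}_{\Xi_{i-1}}(y_i,t_i)$ for $i=1,\dots,n$; the result is $\Xi_n$. - For a non-variable tree $t$ and a variable $x$: $\mathit{unify}_\Xi(t,x)$ is computed by the preceding rules as $\mathit{unify}_\Xi(x,t)$. - $\mathit{unify}_{\Xi_0}(f^n(t_1,\dots,t_n),f^n(t'_1,\dots,t'_n))=\Xi_n$ where $\Xi_i=\mathit{unify}_{\Xi_{i-1}}(t_i,t'_i)$ for $i=1,\dots,n$. - $\mathit{unify}_\Xi(f^n(\dots),g^m(\dots))=\bot$ if $f^n\neq g^m$. *)

theory Defs
  imports Main "HOL-Library.Countable" "HOL-Library.Infinite_Typeclass"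
begin

section \<open>Trees\<close>

text \<open>The datatype contains ill-sorted terms; the set T of finite trees over the signature
  given by \<open>arity\<close> is \<open>trees arity\<close>.\<close>

datatype ('v, 'c) tree = Var 'v | Con 'c "('v, 'c) tree list"

inductive_set trees :: "('c \<Rightarrow> nat) \<Rightarrow> ('v, 'c) tree set" for arity :: "'c \<Rightarrow> nat" where
  var: "Var x \<in> trees arity"
| con: "length ts = arity f \<Longrightarrow> (\<And>t. t \<in> set ts \<Longrightarrow> t \<in> trees arity) \<Longrightarrow> Con f ts \<in> trees arity"

definition head_trees :: "('c \<Rightarrow> nat) \<Rightarrow> ('v, 'c) tree set" where
  "head_trees arity = {Con f (map Var xs) | f xs. length xs = arity f}"

fun tree_vars :: "('v, 'c) tree \<Rightarrow> 'v set" where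
  "tree_vars (Var x) = {x}"
| "tree_vars (Con f ts) = (\<Union>t\<in>set ts. tree_vars t)"

section \<open>Equation systems\<close>

text \<open>The triple \<open>(X, y, t)\<close> is the equation with left-hand side \<open>X\<close>, representing variable
  \<open>y\<close> and right-hand side \<open>t\<close>, where \<open>None\<close> is the missing right-hand side.\<close>

type_synonym ('v, 'c) equation = "'v set \<times> 'v \<times> ('v, 'c) tree option"
type_synonym ('v, 'c) eqs = "('v, 'c) equation set"

definition is_equation :: "('c \<Rightarrow> nat) \<Rightarrow> ('v, 'c) equation \<Rightarrow> bool" where
  "is_equation arity = (\<lambda>(X, y, t). finite X \<and> y \<in> X \<and> (t = None \<or> (\<exists>h\<in>head_trees arity. t = Some h)))"

definition equation_system :: "('c \<Rightarrow> nat) \<Rightarrow> ('v, 'c) eqs \<Rightarrow> bool" where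
  "equation_system arity \<Xi> \<longleftrightarrow>
     finite \<Xi> \<and> (\<forall>e\<in>\<Xi>. is_equation arity e) \<and>
     (\<forall>e\<in>\<Xi>. \<forall>e'\<in>\<Xi>. e \<noteq> e' \<longrightarrow> fst e \<inter> fst e' = {})"

definition eqs_dom :: "('v, 'c) eqs \<Rightarrow> 'v set" where
  "eqs_dom \<Xi> = (\<Union>e\<in>\<Xi>. fst e)"

definition eqs_vars :: "('v, 'c) eqs \<Rightarrow> 'v set" where
  "eqs_vars \<Xi> = eqs_dom \<Xi> \<union> (\<Union>(X, y, t)\<in>\<Xi>. case t of None \<Rightarrow> {} | Some h \<Rightarrow> tree_vars h)"

definition eqs_upd :: "('v, 'c) eqs \<Rightarrow> 'v set \<Rightarrow> 'v \<Rightarrow> ('v, 'c) tree option \<Rightarrow> ('v, 'c) eqs" where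
  "eqs_upd \<Xi> X x t = insert (X, x, t) {e \<in> \<Xi>. fst e \<inter> X = {}}"

text \<open>The equation whose left-hand side contains \<open>x\<close>; only used for \<open>x \<in> eqs_dom \<Xi>\<close>, where it
  is unique if \<open>\<Xi>\<close> is an equation system.\<close>

definition eqn_of :: "('v, 'c) eqs \<Rightarrow> 'v \<Rightarrow> ('v, 'c) equation" where
  "eqn_of \<Xi> x = (THE e. e \<in> \<Xi> \<and> x \<in> fst e)"

definition eqs_find :: "('v, 'c) eqs \<Rightarrow> 'v \<Rightarrow> 'v \<times> ('v, 'c) tree option" where
  "eqs_find \<Xi> x = (if x \<notin> eqs_dom \<Xi> then (x, None) else snd (eqn_of \<Xi> x))"

definition eqs_bind :: "('v, 'c) eqs \<Rightarrow> 'v \<Rightarrow> ('v, 'c) tree \<Rightarrow> ('v, 'c) eqs" where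
  "eqs_bind \<Xi> x t =
     (if x \<notin> eqs_dom \<Xi> then eqs_upd \<Xi> {x} x (Some t)
      else case eqn_of \<Xi> x of (X, x', t') \<Rightarrow> eqs_upd \<Xi> X x' (Some t))"

text \<open>Adding \<open>y \<notin> eqs_dom \<Xi>\<close> to the equation of \<open>x \<in> eqs_dom \<Xi>\<close>.\<close>

definition eqs_extend :: "('v, 'c) eqs \<Rightarrow> 'v \<Rightarrow> 'v \<Rightarrow> ('v, 'c) eqs" where
  "eqs_extend \<Xi> x y = (case eqn_of \<Xi> x of (X, x', t) \<Rightarrow> eqs_upd \<Xi> (X \<union> {y}) x' t)"

definition eqs_union ::
  "('v, 'c) eqs \<Rightarrow> 'v \<Rightarrow> 'v \<Rightarrow> ('v, 'c) eqs \<times> (('v, 'c) tree \<times> ('v, 'c) tree) option" where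
  "eqs_union \<Xi> x y =
    (if x = y then (\<Xi>, None)
     else if x \<notin> eqs_dom \<Xi> \<and> y \<notin> eqs_dom \<Xi> then (eqs_upd \<Xi> {x, y} x None, None)
     else if y \<notin> eqs_dom \<Xi> then (eqs_extend \<Xi> x y, None)
     else if x \<notin> eqs_dom \<Xi> then (eqs_extend \<Xi> y x, None)
     else if eqn_of \<Xi> x = eqn_of \<Xi> y then (\<Xi>, None)
     else case (eqn_of \<Xi> x, eqn_of \<Xi> y) of ((X, x', t1), (Y, y', t2)) \<Rightarrow>
       (case (t1, t2) of
          (Some h1, Some h2) \<Rightarrow> (eqs_upd \<Xi> (X \<union> Y) x' (Some h1), Some (h1, h2))
        | (Some h1, None) \<Rightarrow> (eqs_upd \<Xi> (X \<union> Y) x' (Some h1), None)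
        | (None, Some h2) \<Rightarrow> (eqs_upd \<Xi> (X \<union> Y) x' (Some h2), None)
        | (None, None) \<Rightarrow> (eqs_upd \<Xi> (X \<union> Y) x' None, None)))"

section \<open>The unification algorithm\<close>

text \<open>A strategy for choosing \<open>n\<close> distinct variables outside a finite set \<open>U\<close>.
  In \<open>unify\<close> below, \<open>U\<close> is the set of all variables that occurred so far (in the initial inputs,
  or generated since), and it is threaded through the computation because a variable in use need
  not occur in the current system or arguments. As \<open>U\<close> grows strictly whenever \<open>n > 0\<close>
  variables are chosen, no \<open>U\<close> is queried with \<open>n > 0\<close> twice in one computation, so
  quantifying over these strategies covers all ways of resolving the choices, including
  history-dependent ones.\<close>

definition fresh_choice :: "('v set \<Rightarrow> nat \<Rightarrow> 'v list) \<Rightarrow> bool" where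
  "fresh_choice fresh \<longleftrightarrow>
     (\<forall>U n. finite U \<longrightarrow>
        length (fresh U n) = n \<and> distinct (fresh U n) \<and> set (fresh U n) \<inter> U = {})"

text \<open>\<open>unify\<close> returns \<open>None\<close> for failure. \<open>unify_list\<close> runs the calls for the
  argument lists from left to right. Lists of different lengths do not arise from
  trees in \<open>trees arity\<close>. The function package generates from these equations the call
  relation \<open>unify_unify_list_rel c' c\<close> (the evaluation of call \<open>c\<close> directly makes the recursive
  call \<open>c'\<close>; every call makes at most two) and the domain predicate
  \<open>unify_unify_list_dom\<close>, its accessible part. Here \<open>Inl\<close> tags the arguments of
  \<open>unify\<close> and \<open>Inr\<close> those of \<open>unify_list\<close>.\<close>

function (domintros) unify ::
    "('v set \<Rightarrow> nat \<Rightarrow> 'v list) \<Rightarrow> 'v set \<Rightarrow> ('v, 'c) eqs \<Rightarrow>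
     ('v, 'c) tree \<Rightarrow> ('v, 'c) tree \<Rightarrow> ('v set \<times> ('v, 'c) eqs) option"
  and unify_list ::
    "('v set \<Rightarrow> nat \<Rightarrow> 'v list) \<Rightarrow> 'v set \<Rightarrow> ('v, 'c) eqs \<Rightarrow>
     ('v, 'c) tree list \<Rightarrow> ('v, 'c) tree list \<Rightarrow> ('v set \<times> ('v, 'c) eqs) option" where
  "unify fresh U \<Xi> (Var x) (Var y) =
     (case eqs_union \<Xi> x y of
        (\<Xi>', None) \<Rightarrow> Some (U, \<Xi>')
      | (\<Xi>', Some (t1, t2)) \<Rightarrow> unify fresh U \<Xi>' t1 t2)"
| "unify fresh U \<Xi> (Var x) (Con f ts) =
     (case eqs_find \<Xi> x of
        (x', Some t') \<Rightarrow> unify fresh U \<Xi> t' (Con f ts)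
      | (x', None) \<Rightarrow>
          (let ys = fresh U (length ts) in
           unify_list fresh (U \<union> set ys) (eqs_bind \<Xi> x' (Con f (map Var ys))) (map Var ys) ts))"
| "unify fresh U \<Xi> (Con f ts) (Var x) = unify fresh U \<Xi> (Var x) (Con f ts)"
| "unify fresh U \<Xi> (Con f ts) (Con g ss) =
     (if f = g then unify_list fresh U \<Xi> ts ss else None)"
| "unify_list fresh U \<Xi> [] [] = Some (U, \<Xi>)"
| "unify_list fresh U \<Xi> (t # ts) (s # ss) =
     (case unify fresh U \<Xi> t s of
        None \<Rightarrow> None
      | Some (U', \<Xi>') \<Rightarrow> unify_list fresh U' \<Xi>' ts ss)"
| "unify_list fresh U \<Xi> [] (s # ss) = None"
| "unify_list fresh U \<Xi> (t # ts) [] = None"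
  by pat_completeness auto

definition input_vars :: "('v, 'c) eqs \<Rightarrow> ('v, 'c) tree \<Rightarrow> ('v, 'c) tree \<Rightarrow> 'v set" where
  "input_vars \<Xi> t1 t2 = eqs_vars \<Xi> \<union> tree_vars t1 \<union> tree_vars t2"

end

theory Submission
  imports Defs
begin

text \<open>A call on \<open>\<Xi>, t, s\<close> is given the potential \<open>2 * b + w\<close>, where \<open>b\<close> counts the equations
  of \<open>\<Xi>\<close> with a right-hand side and \<open>w\<close> weighs the pair \<open>t, s\<close>. A recursive call after merging
  two equations destroys one right-hand side, which pays for the comparison of two head trees;
  such trees only produce pairs of variables, of weight \<open>0\<close>. Binding a variable creates a
  right-hand side, but consumes a constructor of an input tree, of weight \<open>3\<close>. As \<open>2 * b\<close> never
  exceeds the potential of the call that produced the system, the potential also controls calls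
  made on the systems resulting from earlier calls.\<close>

section \<open>Finitely many recursive calls\<close>

text \<open>Finite branching and accessibility together give a finite tree of calls. Accessibility
  permits induction: the descendants of \<open>x\<close> are its finitely many immediate
  predecessors and their descendants, and the latter sets are finite by induction.\<close>

lemma finite_tranclp_accp:
  assumes "Wellfounded.accp r x" and "\<And>y. finite {z. r z y}"
  shows "finite {z. r\<^sup>+\<^sup>+ z x}"
  using assms(1)
proof (induction rule: accp.induct)
  case (accI x)
  have "{z. r\<^sup>+\<^sup>+ z x} \<subseteq> {y. r y x} \<union> (\<Union>y\<in>{y. r y x}. {z. r\<^sup>+\<^sup>+ z y})"
    by (auto elim: tranclp.cases)
  moreover have "finite ({y. r y x} \<union> (\<Union>y\<in>{y. r y x}. {z. r\<^sup>+\<^sup>+ z y}))"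
    using assms(2) accI.IH by auto
  ultimately show ?case
    by (rule finite_subset)
qed

text \<open>Supplies the finite branching for arbitrary calls, so it assumes nothing about the
  system or the trees. For each shape of call an explicit set of at most two candidates contains all
  callees.\<close>

lemma finite_unify_unify_list_rel: "finite {c'. unify_unify_list_rel c' c}"
proof (cases c)
  case (Inl a)
  obtain fresh U \<Xi> t s where a: "a = (fresh, U, \<Xi>, t, s)"
    by (cases a)
  show ?thesis
  proof (cases t)
    case t: (Var x)
    show ?thesis
    proof (cases s)
      case (Var y)
      \<comment> \<open>If \<open>h\<close> is \<open>None\<close> there is no callee, and the
        meaningless value \<open>the h\<close> only enlarges the superset.\<close>
      have "{c'. unify_unify_list_rel c' c} \<subseteq>
          {case eqs_union \<Xi> x y of (\<Xi>', h) \<Rightarrow> Inl (fresh, U, \<Xi>', the h)}"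
        unfolding Inl a t Var by (auto elim!: unify_unify_list_rel.cases split: prod.split)
      then show ?thesis
        by (rule finite_subset) simp
    next
      case (Con f ts)
      obtain x' r where "eqs_find \<Xi> x = (x', r)"
        by (cases "eqs_find \<Xi> x")
      then have "{c'. unify_unify_list_rel c' c} \<subseteq>
          {Inl (fresh, U, \<Xi>, the r, Con f ts),
           let ys = fresh U (length ts) in
             Inr (fresh, U \<union> set ys, eqs_bind \<Xi> x' (Con f (map Var ys)), map Var ys, ts)}"
        unfolding Inl a t Con by (auto elim!: unify_unify_list_rel.cases simp: Let_def)
      then show ?thesis
        by (rule finite_subset) simp
    qed
  next
    case t: (Con f ts)
    have "{c'. unify_unify_list_rel c' c} \<subseteq>
        {Inl (fresh, U, \<Xi>, s, t), Inr (fresh, U, \<Xi>, ts, case s of Con g ss \<Rightarrow> ss)}"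
      unfolding Inl a t by (auto elim!: unify_unify_list_rel.cases)
    then show ?thesis
      by (rule finite_subset) simp
  qed
next
  case (Inr a)
  obtain fresh U \<Xi> ts ss where a: "a = (fresh, U, \<Xi>, ts, ss)"
    by (cases a)
  \<comment> \<open>The call on the tails depends on the result of the call on the heads.
    \<open>unify_unify_list_sumC\<close> is the total function on the sum type that underlies both
    functions, so it names this result even when the call on the heads is not known to
    terminate.\<close>
  have "{c'. unify_unify_list_rel c' c} \<subseteq>
      {Inl (fresh, U, \<Xi>, hd ts, hd ss),
       case the (unify_unify_list_sumC (Inl (fresh, U, \<Xi>, hd ts, hd ss))) of
         (U', \<Xi>') \<Rightarrow> Inr (fresh, U', \<Xi>', tl ts, tl ss)}"
    unfolding Inr a
    by (auto elim!: unify_unify_list_rel.cases split: prod.split)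
  then show ?thesis
    by (rule finite_subset) simp
qed

section \<open>Equation systems\<close>

definition bound_eqs :: "('v, 'c) eqs \<Rightarrow> ('v, 'c) eqs" where
  "bound_eqs \<Xi> = {e \<in> \<Xi>. snd (snd e) \<noteq> None}"

text \<open>Disjointness of left-hand sides makes the definite description in \<open>eqn_of\<close>
  well-defined.\<close>

lemma eqn_of_unique:
  assumes "equation_system arity \<Xi>" and "x \<in> eqs_dom \<Xi>"
  shows "eqn_of \<Xi> x \<in> \<Xi>" and "x \<in> fst (eqn_of \<Xi> x)"
proof -
  obtain e where "e \<in> \<Xi>" "x \<in> fst e"
    using assms(2) by (auto simp: eqs_dom_def)
  moreover have "e1 = e2" if "e1 \<in> \<Xi>" "e2 \<in> \<Xi>" "x \<in> fst e1" "x \<in> fst e2" for e1 e2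
    using assms(1) that unfolding equation_system_def by blast
  ultimately have "\<exists>!e. e \<in> \<Xi> \<and> x \<in> fst e"
    by blast
  then have "eqn_of \<Xi> x \<in> \<Xi> \<and> x \<in> fst (eqn_of \<Xi> x)"
    unfolding eqn_of_def by (rule theI')
  then show "eqn_of \<Xi> x \<in> \<Xi>" and "x \<in> fst (eqn_of \<Xi> x)"
    by auto
qed

lemma is_equation_eqn_of:
  assumes "equation_system arity \<Xi>" and "x \<in> eqs_dom \<Xi>"
  shows "is_equation arity (eqn_of \<Xi> x)"
  using assms(1) eqn_of_unique(1)[OF assms] by (simp add: equation_system_def)

lemma equation_system_eqs_upd:
  assumes "equation_system arity \<Xi>" and "is_equation arity (X, x, t)"
  shows "equation_system arity (eqs_upd \<Xi> X x t)"
proof -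
  have "fst e \<inter> fst e' = {}"
    if "e \<in> eqs_upd \<Xi> X x t" "e' \<in> eqs_upd \<Xi> X x t" "e \<noteq> e'" for e e'
  proof -
    have "e = (X, x, t) \<or> e \<in> \<Xi> \<and> fst e \<inter> X = {}" "e' = (X, x, t) \<or> e' \<in> \<Xi> \<and> fst e' \<inter> X = {}"
      using that(1,2) by (simp_all add: eqs_upd_def)
    moreover have "fst e \<inter> fst e' = {}" if "e \<in> \<Xi>" "e' \<in> \<Xi>"
      using assms(1) that \<open>e \<noteq> e'\<close> unfolding equation_system_def by blast
    ultimately show ?thesis
      using that(3) by (elim disjE conjE) (simp_all add: Int_commute)
  qed
  moreover have "finite (eqs_upd \<Xi> X x t)" "\<forall>e\<in>eqs_upd \<Xi> X x t. is_equation arity e"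
    using assms by (simp_all add: equation_system_def eqs_upd_def)
  ultimately show ?thesis
    by (simp add: equation_system_def)
qed

text \<open>\<open>E\<close> is any choice of bound equations that the update erases; at most one
  new bound equation replaces them. Extension and merging take for \<open>E\<close> the old
  equations that have a right-hand side, and binding takes \<open>{}\<close>. The additive form
  avoids truncated subtraction.\<close>

lemma card_bound_eqs_upd:
  assumes "finite \<Xi>" and "E \<subseteq> bound_eqs \<Xi>" and "\<And>e. e \<in> E \<Longrightarrow> fst e \<inter> X \<noteq> {}"
  shows "card (bound_eqs (eqs_upd \<Xi> X x t)) + card E
    \<le> card (bound_eqs \<Xi>) + (if t = None then 0 else 1)"
proof -
  let ?N = "if t = None then {} else {(X, x, t)}"
  have fin: "finite (bound_eqs \<Xi>)"
    using assms(1) by (simp add: bound_eqs_def)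
  then have "finite E"
    using assms(2) by (rule rev_finite_subset)
  have "bound_eqs (eqs_upd \<Xi> X x t) \<subseteq> ?N \<union> (bound_eqs \<Xi> - E)"
    using assms(3) by (auto simp: bound_eqs_def eqs_upd_def)
  then have "card (bound_eqs (eqs_upd \<Xi> X x t)) \<le> card (?N \<union> (bound_eqs \<Xi> - E))"
    by (rule card_mono[rotated]) (simp add: fin)
  also have "\<dots> \<le> card ?N + card (bound_eqs \<Xi> - E)"
    by (rule card_Un_le)
  also have "card (bound_eqs \<Xi> - E) = card (bound_eqs \<Xi>) - card E"
    using \<open>finite E\<close> assms(2) by (rule card_Diff_subset)
  finally show ?thesis
    using card_mono[OF fin assms(2)] by (auto split: if_splits)
qed

section \<open>Change in the number of bound equations under binding, extension and union\<close>

lemma eqs_bind_bound: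
  assumes "equation_system arity \<Xi>" and "h \<in> head_trees arity"
  shows "equation_system arity (eqs_bind \<Xi> x h)"
    and "card (bound_eqs (eqs_bind \<Xi> x h)) \<le> card (bound_eqs \<Xi>) + 1"
proof -
  have fin: "finite \<Xi>"
    using assms(1) by (simp add: equation_system_def)
  obtain X y t where e: "eqn_of \<Xi> x = (X, y, t)"
    by (cases "eqn_of \<Xi> x")
  \<comment> \<open>Both branches of \<open>eqs_bind\<close> are a single update: with
    \<open>{x}\<close> and \<open>x\<close> outside the domain, with the components of
    \<open>eqn_of \<Xi> x\<close> inside it.\<close>
  have upd: "\<exists>X y. eqs_bind \<Xi> x h = eqs_upd \<Xi> X y (Some h) \<and> is_equation arity (X, y, Some h)"
    using is_equation_eqn_of[OF assms(1), of x] assms(2) e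
    by (cases "x \<in> eqs_dom \<Xi>") (auto simp: eqs_bind_def is_equation_def)
  then show "equation_system arity (eqs_bind \<Xi> x h)"
    using equation_system_eqs_upd[OF assms(1)] by metis
  show "card (bound_eqs (eqs_bind \<Xi> x h)) \<le> card (bound_eqs \<Xi>) + 1"
    using upd card_bound_eqs_upd[OF fin, of "{}" _ _ "Some h"] by auto
qed

lemma eqs_find_head_tree:
  assumes "equation_system arity \<Xi>" and "eqs_find \<Xi> x = (x', Some h)"
  shows "h \<in> head_trees arity"
  using assms is_equation_eqn_of[OF assms(1), of x]
  by (cases "eqn_of \<Xi> x") (auto simp: eqs_find_def is_equation_def split: if_splits)

lemma eqs_extend_bound:
  assumes "equation_system arity \<Xi>" and "x \<in> eqs_dom \<Xi>"
  shows "equation_system arity (eqs_extend \<Xi> x y)"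
    and "card (bound_eqs (eqs_extend \<Xi> x y)) \<le> card (bound_eqs \<Xi>)"
proof -
  have fin: "finite \<Xi>"
    using assms(1) by (simp add: equation_system_def)
  obtain X x' t where e: "eqn_of \<Xi> x = (X, x', t)"
    by (cases "eqn_of \<Xi> x")
  have ext: "eqs_extend \<Xi> x y = eqs_upd \<Xi> (X \<union> {y}) x' t"
    by (simp add: eqs_extend_def e)
  have "is_equation arity (X \<union> {y}, x', t)"
    using is_equation_eqn_of[OF assms] by (simp add: e is_equation_def)
  then show "equation_system arity (eqs_extend \<Xi> x y)"
    unfolding ext by (rule equation_system_eqs_upd[OF assms(1)])
  have "(X, x', t) \<in> \<Xi>" "x \<in> X"
    using eqn_of_unique[OF assms] by (auto simp: e)
  then show "card (bound_eqs (eqs_extend \<Xi> x y)) \<le> card (bound_eqs \<Xi>)"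
    unfolding ext
    using card_bound_eqs_upd[OF fin, of "if t = None then {} else {(X, x', t)}" "X \<union> {y}" x' t]
    by (cases t) (auto simp: bound_eqs_def)
qed

text \<open>Letting \<open>t\<close> range over \<open>{t1, t2}\<close> treats all four combinations
  of present and missing right-hand sides at once.\<close>

lemma eqs_union_merge:
  assumes "equation_system arity \<Xi>" and "x \<in> eqs_dom \<Xi>" and "y \<in> eqs_dom \<Xi>"
    and e: "eqn_of \<Xi> x = (X, x', t1)" "eqn_of \<Xi> y = (Y, y', t2)"
    and ne: "eqn_of \<Xi> x \<noteq> eqn_of \<Xi> y" and t: "t \<in> {t1, t2}"
  shows "equation_system arity (eqs_upd \<Xi> (X \<union> Y) x' t)"
    and "card (bound_eqs (eqs_upd \<Xi> (X \<union> Y) x' t)) \<le> card (bound_eqs \<Xi>)"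
    and "t1 \<noteq> None \<Longrightarrow> t2 \<noteq> None \<Longrightarrow>
      card (bound_eqs (eqs_upd \<Xi> (X \<union> Y) x' t)) < card (bound_eqs \<Xi>)"
proof -
  have fin: "finite \<Xi>"
    using assms(1) by (simp add: equation_system_def)
  have "is_equation arity (X \<union> Y, x', t)"
    using is_equation_eqn_of[OF assms(1,2)] is_equation_eqn_of[OF assms(1,3)] t
    by (auto simp: e is_equation_def)
  then show "equation_system arity (eqs_upd \<Xi> (X \<union> Y) x' t)"
    by (rule equation_system_eqs_upd[OF assms(1)])
  \<comment> \<open>If the merged equation has a right-hand side, it is inherited from a member of
    \<open>E\<close>, so \<open>E\<close> has at least one element to offset it. If both old
    equations are bound, \<open>E\<close> has two elements and one right-hand side is lost.\<close>
  define E where "E = {e \<in> {(X, x', t1), (Y, y', t2)}. snd (snd e) \<noteq> None}"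
  have "(X, x', t1) \<in> \<Xi>" "(Y, y', t2) \<in> \<Xi>" "x \<in> X" "y \<in> Y"
    using eqn_of_unique[OF assms(1,2)] eqn_of_unique[OF assms(1,3)] by (auto simp: e)
  then have le: "card (bound_eqs (eqs_upd \<Xi> (X \<union> Y) x' t)) + card E
      \<le> card (bound_eqs \<Xi>) + (if t = None then 0 else 1)"
    by (intro card_bound_eqs_upd fin) (auto simp: bound_eqs_def E_def)
  have "finite E"
    by (simp add: E_def)
  moreover have "E \<noteq> {}" if "t \<noteq> None"
    using t that by (auto simp: E_def)
  ultimately have "(if t = None then 0 else 1) \<le> card E"
    by (simp add: Suc_le_eq card_gt_0_iff)
  then show "card (bound_eqs (eqs_upd \<Xi> (X \<union> Y) x' t)) \<le> card (bound_eqs \<Xi>)"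
    using le by linarith
  show "card (bound_eqs (eqs_upd \<Xi> (X \<union> Y) x' t)) < card (bound_eqs \<Xi>)"
    if "t1 \<noteq> None" "t2 \<noteq> None"
  proof -
    have "E = {(X, x', t1), (Y, y', t2)}"
      using that by (auto simp: E_def)
    \<comment> \<open>Without distinctness the two triples could collapse to one element, and
      nothing would be lost.\<close>
    moreover have "(X, x', t1) \<noteq> (Y, y', t2)"
      using ne by (simp only: e) simp
    ultimately have "card E = 2"
      by (simp only: card_2_iff) blast
    moreover have "(if t = None then 0 else 1) \<le> (1::nat)"
      by simp
    ultimately show ?thesis
      using le by linarith
  qed
qed

lemma eqs_union_bound:
  assumes "equation_system arity \<Xi>" and "eqs_union \<Xi> x y = (\<Xi>', r)"
  shows "equation_system arity \<Xi>'"
    and "card (bound_eqs \<Xi>') \<le> card (bound_eqs \<Xi>)"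
    and "r = Some (h1, h2) \<Longrightarrow> h1 \<in> head_trees arity \<and> h2 \<in> head_trees arity \<and>
      card (bound_eqs \<Xi>') < card (bound_eqs \<Xi>)"
proof -
  have fin: "finite \<Xi>"
    using assms(1) by (simp add: equation_system_def)
  have "equation_system arity \<Xi>' \<and> card (bound_eqs \<Xi>') \<le> card (bound_eqs \<Xi>) \<and>
    (\<forall>h1 h2. r = Some (h1, h2) \<longrightarrow> h1 \<in> head_trees arity \<and> h2 \<in> head_trees arity \<and>
      card (bound_eqs \<Xi>') < card (bound_eqs \<Xi>))"
  \<comment> \<open>This isolates the merge of two distinct equations, the only case that can return
    head trees. In the other cases the system is unchanged, gains an equation without right-hand
    side, or has one equation extended.\<close>
  proof (cases "x \<noteq> y \<and> x \<in> eqs_dom \<Xi> \<and> y \<in> eqs_dom \<Xi> \<and> eqn_of \<Xi> x \<noteq> eqn_of \<Xi> y")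
    case True
    obtain X x' t1 Y y' t2 where e: "eqn_of \<Xi> x = (X, x', t1)" "eqn_of \<Xi> y = (Y, y', t2)"
      by (metis prod_cases3)
    note merge = eqs_union_merge[OF assms(1) _ _ e]
    have eq: "is_equation arity (X, x', t1)" "is_equation arity (Y, y', t2)"
      using True is_equation_eqn_of[OF assms(1)] e by metis+
    show ?thesis
    proof (cases "t1 \<noteq> None \<and> t2 \<noteq> None")
      case both: True
      then obtain h1 h2 where [simp]: "t1 = Some h1" "t2 = Some h2"
        by auto
      have "\<Xi>' = eqs_upd \<Xi> (X \<union> Y) x' t1" "r = Some (h1, h2)"
        using assms(2) True by (simp_all add: eqs_union_def) (simp_all add: e)
      then show ?thesis
        using merge[of t1] True eq by (auto simp: is_equation_def less_imp_le)
    next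
      case False
      then have "\<exists>t\<in>{t1, t2}. \<Xi>' = eqs_upd \<Xi> (X \<union> Y) x' t" "r = None"
        using assms(2) True
        by (simp_all add: eqs_union_def) (auto simp: e split: option.splits)
      then show ?thesis
        using merge True by auto
    qed
  next
    case False
    consider "\<Xi>' = \<Xi>" "r = None"
      | "\<Xi>' = eqs_upd \<Xi> {x, y} x None" "r = None"
      | "x \<in> eqs_dom \<Xi>" "\<Xi>' = eqs_extend \<Xi> x y" "r = None"
      | "y \<in> eqs_dom \<Xi>" "\<Xi>' = eqs_extend \<Xi> y x" "r = None"
      using assms(2) False
      by (cases "x = y"; cases "x \<in> eqs_dom \<Xi>"; cases "y \<in> eqs_dom \<Xi>")
        (simp_all add: eqs_union_def)
    then show ?thesis
    proof cases
      case 2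
      have "is_equation arity ({x, y}, x, None)"
        by (simp add: is_equation_def)
      then show ?thesis
        using 2 equation_system_eqs_upd[OF assms(1)]
          card_bound_eqs_upd[OF fin, of "{}" "{x, y}" x None] by auto
    qed (use assms(1) eqs_extend_bound[OF assms(1)] in auto)
  qed
  then show "equation_system arity \<Xi>'"
    and "card (bound_eqs \<Xi>') \<le> card (bound_eqs \<Xi>)"
    and "r = Some (h1, h2) \<Longrightarrow> h1 \<in> head_trees arity \<and> h2 \<in> head_trees arity \<and>
      card (bound_eqs \<Xi>') < card (bound_eqs \<Xi>)"
    by auto
qed

section \<open>Weights\<close>

primrec con_count :: "('v, 'c) tree \<Rightarrow> nat" where
  "con_count (Var x) = 0"
| "con_count (Con f ts) = Suc (sum_list (map con_count ts))"

text \<open>The additive \<open>1\<close> in the third equation pays for swapping the arguments.\<close>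

fun weight :: "('v, 'c) tree \<Rightarrow> ('v, 'c) tree \<Rightarrow> nat"
  and list_weight :: "('v, 'c) tree list \<Rightarrow> ('v, 'c) tree list \<Rightarrow> nat" where
  "weight (Var x) (Var y) = 0"
| "weight (Var x) (Con f ts) = 3 * con_count (Con f ts)"
| "weight (Con f ts) (Var x) = 3 * con_count (Con f ts) + 1"
| "weight (Con f ts) (Con g ss) = Suc (list_weight ts ss)"
| "list_weight (t # ts) (s # ss) = weight t s + list_weight ts ss"
| "list_weight _ _ = 0"

lemma weight_Var_left: "weight (Var x) t = 3 * con_count t"
  by (cases t) auto

text \<open>Only an inequality holds, because \<open>list_weight\<close> stops at the end of the
  shorter list.\<close>

lemma list_weight_map_Var_left:
  "list_weight (map Var xs) ts \<le> 3 * sum_list (map con_count ts)"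
proof (induction xs arbitrary: ts)
  case (Cons x xs)
  then show ?case
    by (cases ts) (auto simp: weight_Var_left)
qed simp

lemma list_weight_map_Var: "list_weight (map Var xs) (map Var ys) = 0"
  using list_weight_map_Var_left[of xs "map Var ys"] by (simp add: comp_def)

lemma weight_head_trees:
  "h \<in> head_trees arity \<Longrightarrow> h' \<in> head_trees arity \<Longrightarrow> weight h h' \<le> 1"
  by (auto simp: head_trees_def list_weight_map_Var)

text \<open>With \<open>n\<close> constructors in \<open>ts\<close>, the left side is at most
  \<open>1 + 3 * n\<close> and the right side is \<open>3 + 3 * n\<close>. This makes the potential
  drop when a variable is replaced by its right-hand side.\<close>

lemma weight_head_tree_Con:
  "h \<in> head_trees arity \<Longrightarrow> weight h (Con f ts) < 3 * con_count (Con f ts)"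
  using list_weight_map_Var_left by (fastforce simp: head_trees_def less_Suc_eq_le intro: le_SucI)

lemma head_trees_subset: "head_trees arity \<subseteq> trees arity"
  by (auto simp: head_trees_def intro!: trees.intros)

section \<open>Termination\<close>

context
  fixes arity :: "'c \<Rightarrow> nat" and fresh :: "'v set \<Rightarrow> nat \<Rightarrow> 'v list"
begin

text \<open>Finiteness of \<open>U\<close> is included because \<open>fresh_choice\<close>
  constrains the strategy only on finite sets.\<close>

definition valid_state :: "'v set \<Rightarrow> ('v, 'c) eqs \<Rightarrow> bool" where
  "valid_state U \<Xi> \<longleftrightarrow> finite U \<and> equation_system arity \<Xi>"

definition bounded_result :: "nat \<Rightarrow> ('v set \<times> ('v, 'c) eqs) option \<Rightarrow> bool" where
  "bounded_result m r \<longleftrightarrow>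
     (\<forall>U \<Xi>. r = Some (U, \<Xi>) \<longrightarrow> valid_state U \<Xi> \<and> 2 * card (bound_eqs \<Xi>) \<le> m)"

text \<open>Termination and the bound on the result are proved together: the recursion is nested, so
  termination of a later call in a list depends on the system that earlier calls return. Failure
  satisfies every bound.\<close>

definition unify_ok :: "'v set \<Rightarrow> ('v, 'c) eqs \<Rightarrow> ('v, 'c) tree \<Rightarrow> ('v, 'c) tree \<Rightarrow> bool" where
  "unify_ok U \<Xi> t s \<longleftrightarrow> unify_unify_list_dom (Inl (fresh, U, \<Xi>, t, s)) \<and>
     bounded_result (2 * card (bound_eqs \<Xi>) + weight t s) (unify fresh U \<Xi> t s)"

definition unify_list_ok ::
    "'v set \<Rightarrow> ('v, 'c) eqs \<Rightarrow> ('v, 'c) tree list \<Rightarrow> ('v, 'c) tree list \<Rightarrow> bool" where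
  "unify_list_ok U \<Xi> ts ss \<longleftrightarrow> unify_unify_list_dom (Inr (fresh, U, \<Xi>, ts, ss)) \<and>
     bounded_result (2 * card (bound_eqs \<Xi>) + list_weight ts ss) (unify_list fresh U \<Xi> ts ss)"

lemma bounded_result_mono: "bounded_result m r \<Longrightarrow> m \<le> n \<Longrightarrow> bounded_result n r"
  by (auto simp: bounded_result_def)

text \<open>List calls need no drop in potential, since the lists get shorter. A fixed bound
  \<open>m\<close> serves all elements: after the first pair, twice the number of bound equations is
  at most its old value plus \<open>weight t s\<close>, so adding the weight of the tails stays
  within \<open>m\<close>.\<close>

lemma unify_list_ok:
  assumes ok: "\<And>U \<Xi> t s. valid_state U \<Xi> \<Longrightarrow> t \<in> trees arity \<Longrightarrow> s \<in> trees arity \<Longrightarrow>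
      2 * card (bound_eqs \<Xi>) + weight t s \<le> m \<Longrightarrow> unify_ok U \<Xi> t s"
    and "valid_state U \<Xi>" and "set ts \<subseteq> trees arity" and "set ss \<subseteq> trees arity"
    and "2 * card (bound_eqs \<Xi>) + list_weight ts ss \<le> m"
  shows "unify_list_ok U \<Xi> ts ss"
  using assms(2-)
proof (induction ts arbitrary: ss U \<Xi>)
  case Nil
  have "unify_unify_list_dom (Inr (fresh, U, \<Xi>, [], ss))"
    by (cases ss) (auto intro: unify_unify_list.domintros)
  then show ?case
    using Nil.prems(1)
    by (cases ss) (auto simp: unify_list_ok_def bounded_result_def unify_list.psimps)
next
  case (Cons t ts ss)
  show ?case
  proof (cases ss)
    case Nil
    have "unify_unify_list_dom (Inr (fresh, U, \<Xi>, t # ts, []))"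
      by (intro unify_unify_list.domintros)
    then show ?thesis
      by (simp add: Nil unify_list_ok_def bounded_result_def unify_list.psimps)
  next
    case ss: (Cons s ss')
    have u: "unify_ok U \<Xi> t s"
      using Cons.prems by (intro ok) (auto simp: ss)
    have rest: "unify_list_ok U' \<Xi>' ts ss' \<and>
        2 * card (bound_eqs \<Xi>') \<le> 2 * card (bound_eqs \<Xi>) + weight t s"
      if "unify fresh U \<Xi> t s = Some (U', \<Xi>')" for U' \<Xi>'
      using u that Cons.prems
      by (auto simp: ss unify_ok_def bounded_result_def intro!: Cons.IH)
    have dom: "unify_unify_list_dom (Inr (fresh, U, \<Xi>, t # ts, s # ss'))"
      using u rest by (intro unify_unify_list.domintros) (auto simp: unify_ok_def unify_list_ok_def)
    then show ?thesis
      using rest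
      by (force simp: ss unify_list_ok_def unify_list.psimps bounded_result_def
          split: option.splits)
  qed
qed

text \<open>Complete induction on the potential: every direct callee, whether on trees or on lists,
  has a strictly smaller one.\<close>

lemma unify_ok:
  assumes fresh: "fresh_choice fresh"
    and "valid_state U \<Xi>" and "t \<in> trees arity" and "s \<in> trees arity"
  shows "unify_ok U \<Xi> t s"
  using assms(2-)
proof (induction "2 * card (bound_eqs \<Xi>) + weight t s" arbitrary: U \<Xi> t s rule: less_induct)
  case less
  let ?m = "2 * card (bound_eqs \<Xi>) + weight t s"
  \<comment> \<open>The calls on trees made by this list call have at most its potential, hence less
    than \<open>?m\<close>, and the induction hypothesis covers them.\<close>
  have list_ok: "unify_list_ok U' \<Xi>' ts ss"
    if "valid_state U' \<Xi>'" "set ts \<subseteq> trees arity" "set ss \<subseteq> trees arity"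
      "2 * card (bound_eqs \<Xi>') + list_weight ts ss < ?m" for U' \<Xi>' ts ss
  proof (rule unify_list_ok[OF _ that(1-3) order_refl])
    show "unify_ok U'' \<Xi>'' t' s'"
      if "valid_state U'' \<Xi>''" "t' \<in> trees arity" "s' \<in> trees arity"
        "2 * card (bound_eqs \<Xi>'') + weight t' s' \<le> 2 * card (bound_eqs \<Xi>') + list_weight ts ss"
      for U'' \<Xi>'' t' s'
      using that \<open>_ < ?m\<close> by (intro less.hyps) auto
  qed
  have sys: "equation_system arity \<Xi>" and U: "finite U"
    using less.prems by (auto simp: valid_state_def)
  have Var_Con: ?case if t: "t = Var x" and s: "s = Con f ts" for x f ts
  proof -
    obtain x' r where find: "eqs_find \<Xi> x = (x', r)"
      by (cases "eqs_find \<Xi> x")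
    have ts: "length ts = arity f" "set ts \<subseteq> trees arity"
      using less.prems(3) by (auto simp: s elim: trees.cases)
    show ?thesis
    proof (cases r)
      case None
      define ys where "ys = fresh U (length ts)"
      define \<Xi>' where "\<Xi>' = eqs_bind \<Xi> x' (Con f (map Var ys))"
      have "length ys = arity f"
        using fresh U ts(1) by (simp add: ys_def fresh_choice_def)
      then have "Con f (map Var ys) \<in> head_trees arity"
        by (auto simp: head_trees_def)
      note bind = eqs_bind_bound[OF sys this, of x', folded \<Xi>'_def]
      \<comment> \<open>Here the factor 3 matters: binding adds at most 2 to the first summand,
        while removing the root constructor of \<open>s\<close> frees 3 from the weight.\<close>
      have pot: "2 * card (bound_eqs \<Xi>') + list_weight (map Var ys) ts < ?m"
        using bind(2) list_weight_map_Var_left[of ys ts] by (simp add: t s)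
      have "unify_list_ok (U \<union> set ys) \<Xi>' (map Var ys) ts"
        using bind(1) U ts pot
        by (intro list_ok) (auto simp: valid_state_def intro: trees.intros)
      moreover from this have "unify_unify_list_dom (Inl (fresh, U, \<Xi>, Var x, Con f ts))"
        by (intro unify_unify_list.domintros)
          (auto simp: find None unify_list_ok_def ys_def \<Xi>'_def)
      ultimately show ?thesis
        using pot
        by (auto simp: unify_ok_def unify_list_ok_def t s unify.psimps find None Let_def
            ys_def[symmetric] \<Xi>'_def[symmetric] elim: bounded_result_mono)
    next
      case (Some h)
      have h: "h \<in> head_trees arity"
        using eqs_find_head_tree[OF sys] find Some by simp
      have pot: "weight h s < weight t s"
        using weight_head_tree_Con[OF h] by (simp add: t s)
      have "unify_ok U \<Xi> h s"
        using h head_trees_subset less.prems pot by (intro less.hyps) auto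
      moreover from this have "unify_unify_list_dom (Inl (fresh, U, \<Xi>, Var x, Con f ts))"
        by (intro unify_unify_list.domintros) (auto simp: find Some s unify_ok_def)
      ultimately show ?thesis
        using pot
        by (auto simp: unify_ok_def t s unify.psimps find Some elim: bounded_result_mono)
    qed
  qed
  show ?case
  proof (cases t)
    case t: (Var x)
    show ?thesis
    proof (cases s)
      case s: (Var y)
      obtain \<Xi>' r where un: "eqs_union \<Xi> x y = (\<Xi>', r)"
        by (cases "eqs_union \<Xi> x y")
      note un_bound = eqs_union_bound[OF sys un]
      show ?thesis
      proof (cases r)
        case None
        have "unify_unify_list_dom (Inl (fresh, U, \<Xi>, Var x, Var y))"
          by (intro unify_unify_list.domintros) (auto simp: un None)
        then show ?thesis
          using un_bound U
          by (auto simp: unify_ok_def bounded_result_def valid_state_def t s unify.psimps un None)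
      next
        case (Some p)
        obtain h1 h2 where r: "r = Some (h1, h2)"
          using Some by (cases p) auto
        note h = un_bound(3)[OF r]
        \<comment> \<open>Losing a right-hand side lowers the first summand by at least 2, and the
          weight rises from 0 to at most 1.\<close>
        have pot: "2 * card (bound_eqs \<Xi>') + weight h1 h2 < ?m"
          using h weight_head_trees[of h1 arity h2] by auto
        have "unify_ok U \<Xi>' h1 h2"
          using h head_trees_subset un_bound(1) U pot
          by (intro less.hyps) (auto simp: valid_state_def)
        moreover from this have "unify_unify_list_dom (Inl (fresh, U, \<Xi>, Var x, Var y))"
          by (intro unify_unify_list.domintros) (auto simp: un r unify_ok_def)
        ultimately show ?thesis
          using pot
          by (auto simp: unify_ok_def t s unify.psimps un r elim: bounded_result_mono)
      qed
    next
      case (Con f ts)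
      then show ?thesis
        by (rule Var_Con[OF t])
    qed
  next
    case t: (Con f ts)
    show ?thesis
    proof (cases s)
      case s: (Var x)
      have "unify_ok U \<Xi> s t"
        using less.prems by (intro less.hyps) (auto simp: t s)
      moreover from this have "unify_unify_list_dom (Inl (fresh, U, \<Xi>, Con f ts, Var x))"
        by (auto simp: t s unify_ok_def intro: unify_unify_list.domintros(3))
      ultimately show ?thesis
        by (auto simp: unify_ok_def t s unify.psimps(3) elim: bounded_result_mono)
    next
      case s: (Con g ss)
      have "set ts \<subseteq> trees arity" "set ss \<subseteq> trees arity"
        using less.prems by (auto simp: t s elim: trees.cases)
      \<comment> \<open>This holds even if \<open>f\<close> and \<open>g\<close> differ, since
        \<open>unify_list_ok\<close> permits lists of different lengths; the \<open>Suc\<close> in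
        \<open>weight\<close> gives the strict drop.\<close>
      then have "unify_list_ok U \<Xi> ts ss"
        using less.prems by (intro list_ok) (auto simp: t s)
      moreover from this have "unify_unify_list_dom (Inl (fresh, U, \<Xi>, Con f ts, Con g ss))"
        by (intro unify_unify_list.domintros) (auto simp: unify_list_ok_def)
      moreover have "bounded_result n None" for n
        by (simp add: bounded_result_def)
      ultimately show ?thesis
        by (auto simp: unify_ok_def unify_list_ok_def t s unify.psimps
            elim: bounded_result_mono)
    qed
  qed
qed

end

section \<open>Finiteness of the initial variable set, and the conclusion\<close>

lemma finite_tree_vars: "finite (tree_vars t)"
  by (induction t) auto

lemma finite_input_vars:
  assumes "equation_system arity \<Xi>"
  shows "finite (input_vars \<Xi> t1 t2)"
  using assms
  by (fastforce simp: equation_system_def is_equation_def input_vars_def eqs_vars_def eqs_dom_def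
      finite_tree_vars split: option.split)

theorem mainTheorem1:
  fixes arity :: "'c::{countable,infinite} \<Rightarrow> nat"
    and \<Xi> :: "('v::{countable,infinite}, 'c) eqs"
    and t1 t2 :: "('v, 'c) tree"
    and fresh :: "'v set \<Rightarrow> nat \<Rightarrow> 'v list"
  assumes "equation_system arity \<Xi>"
    and "t1 \<in> trees arity" and "t2 \<in> trees arity"
    and "fresh_choice fresh"
  shows "unify_unify_list_dom (Inl (fresh, input_vars \<Xi> t1 t2, \<Xi>, t1, t2)) \<and>
    finite {c. unify_unify_list_rel\<^sup>+\<^sup>+ c (Inl (fresh, input_vars \<Xi> t1 t2, \<Xi>, t1, t2))} \<and>
    (unify fresh (input_vars \<Xi> t1 t2) \<Xi> t1 t2 = None \<or>
     (\<exists>U \<Xi>'. unify fresh (input_vars \<Xi> t1 t2) \<Xi> t1 t2 = Some (U, \<Xi>') \<and>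
       equation_system arity \<Xi>'))"
proof -
  have "valid_state arity (input_vars \<Xi> t1 t2) \<Xi>"
    using assms(1) by (simp add: valid_state_def finite_input_vars)
  then have ok: "unify_ok arity fresh (input_vars \<Xi> t1 t2) \<Xi> t1 t2"
    by (rule unify_ok[OF assms(4) _ assms(2,3)])
  then have dom: "unify_unify_list_dom (Inl (fresh, input_vars \<Xi> t1 t2, \<Xi>, t1, t2))"
    by (simp add: unify_ok_def)
  moreover have "finite {c. unify_unify_list_rel\<^sup>+\<^sup>+ c (Inl (fresh, input_vars \<Xi> t1 t2, \<Xi>, t1, t2))}"
    by (rule finite_tranclp_accp[OF dom finite_unify_unify_list_rel])
  moreover have "unify fresh (input_vars \<Xi> t1 t2) \<Xi> t1 t2 = None \<or>
     (\<exists>U \<Xi>'. unify fresh (input_vars \<Xi> t1 t2) \<Xi> t1 t2 = Some (U, \<Xi>') \<and>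
       equation_system arity \<Xi>')"
    using ok
    by (cases "unify fresh (input_vars \<Xi> t1 t2) \<Xi> t1 t2")
      (auto simp: unify_ok_def bounded_result_def valid_state_def)
  ultimately show ?thesis
    by blast
qed

end
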